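(* Let $d\ge 1$, let $n = 3^d$, and let $A_d\in\mathbb{Z}^{d\times n}$ be the design matrix of the $d$-cube $C_d=[-1,1]^d$, whose columns are the $3^d$ vectors of $\{-1,0,1\}^d$; write $a_{ki}$ for its $(k,i)$-entry. Let $c_{k,-1},c_{k,0},c_{k,1}\in\mathbb{C}^*$ for $k\in\{1,\dots,d\}$, and let $c\in(\mathbb{C}^* )^n$ be the scaling of product form $$c_i = \prod_{k=1}^d c_{k,a_{ki}},\qquad i=1,\dots,n.$$ If $c_{k,-1} = \dfrac{c_{k,0}^2}{4c_{k,1}}$ for all $k\in\{1,\dots,d\}$, then the scaled toric variety $V_{A_d}^c$ (the scaled model of $C_d$) has ML degree one.
   Context: For $A=[a_1\ \cdots\ a_n]\in\mathbb{Z}^{d\times n}$ let $A'$ be $A$ with an additional first row of ones. For a scaling $c\in(\mathbb{C}^* )^n$, the scaled toric variety $V_A^c\subseteq\mathbb{C}^n$ is the Zariski closure of the image of $\psi_A^c:(\mathbb{C}^* )^{d+1}\to(\mathbb{C}^* )^n$, $(s,\theta)\mapsto(c_1s\theta^{a_1},\dots,c_ns\theta^{a_n})$. For data $u\in\mathbb{N}^n$ with $u_+=\sum_i u_i$, the score equations are $A'p=\frac{1}{u_+}A'u$ with $p\in V_A^c\cap(\mathbb{C}^* )^n$, and the ML degree $\mathrm{mldeg}(V_A^c)$ is the number of complex solutions $p$ for generic $u$. *)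

theory Defs
  imports "HOL-Analysis.Analysis" "HOL-Library.Poly_Mapping"
begin

section \<open>Zariski topology on complex affine space\<close>

text \<open>Polynomials in the variables indexed by \<open>'n\<close> with complex coefficients are finitely
  supported maps from exponent vectors to coefficients.\<close>

type_synonym 'n cpoly = "('n \<Rightarrow>\<^sub>0 nat) \<Rightarrow>\<^sub>0 complex"

definition poly_value :: "'n::finite cpoly \<Rightarrow> complex ^ 'n \<Rightarrow> complex" where
  "poly_value f x = (\<Sum>m\<in>Poly_Mapping.keys f. Poly_Mapping.lookup f m *
      (\<Prod>i\<in>UNIV. (x $ i) ^ Poly_Mapping.lookup m i))"

definition zariski_closed :: "(complex ^ 'n::finite) set \<Rightarrow> bool" where
  "zariski_closed Z \<longleftrightarrow> (\<exists>F. Z = {x. \<forall>f\<in>F. poly_value f x = 0})"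

definition zariski_closure :: "(complex ^ 'n::finite) set \<Rightarrow> (complex ^ 'n) set" where
  "zariski_closure S = zariski_closed hull S"

section \<open>Scaled toric varieties and their maximum likelihood degree\<close>

definition torus :: "(complex ^ 'n::finite) set" where
  "torus = {p. \<forall>i. p $ i \<noteq> 0}"

text \<open>The matrix \<open>A'\<close>: its rows are indexed by \<open>'d option\<close>, the additional first row of ones
  having index \<open>None\<close>.\<close>

definition augment :: "int ^ 'n ^ 'd \<Rightarrow> int ^ 'n ^ ('d::finite option)" where
  "augment A = (\<chi> r i. case r of None \<Rightarrow> 1 | Some k \<Rightarrow> A $ k $ i)"

definition toric_param ::
    "int ^ 'n ^ 'd::finite \<Rightarrow> complex ^ 'n \<Rightarrow> complex \<Rightarrow> complex ^ 'd \<Rightarrow> complex ^ 'n::finite" where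
  "toric_param A c s \<theta> = (\<chi> i. c $ i * s * (\<Prod>k\<in>UNIV. (\<theta> $ k) powi (A $ k $ i)))"

definition scaled_toric_variety ::
    "int ^ 'n ^ 'd::finite \<Rightarrow> complex ^ 'n \<Rightarrow> (complex ^ 'n::finite) set" where
  "scaled_toric_variety A c = zariski_closure {toric_param A c s \<theta> | s \<theta>. s \<noteq> 0 \<and> \<theta> \<in> torus}"

text \<open>For \<open>u = 0\<close> the right-hand side of the score equations is the junk value \<open>0\<close>; this is
  harmless, as only generic \<open>u\<close> matter below.\<close>

definition score_solutions ::
    "int ^ 'n ^ 'd::finite \<Rightarrow> complex ^ 'n \<Rightarrow> nat ^ 'n \<Rightarrow> (complex ^ 'n::finite) set" where
  "score_solutions A c u =
     (let A' = (\<chi> r i. of_int (augment A $ r $ i)) :: complex ^ 'n ^ ('d option);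
          u' = (\<chi> i. of_nat (u $ i)) :: complex ^ 'n;
          u_plus = (\<Sum>i\<in>UNIV. u $ i)
      in {p \<in> scaled_toric_variety A c \<inter> torus. A' *v p = (1 / of_nat u_plus) *s (A' *v u')})"

text \<open>A property holds for generic data \<open>u \<in> \<nat>\<^sup>n\<close> if it holds for all such \<open>u\<close> in some nonempty
  Zariski open subset of affine space.\<close>

definition for_generic_data :: "(nat ^ 'n::finite \<Rightarrow> bool) \<Rightarrow> bool" where
  "for_generic_data P \<longleftrightarrow>
     (\<exists>Z. zariski_closed Z \<and> Z \<noteq> UNIV \<and> (\<forall>u. (\<chi> i. of_nat (u $ i)) \<notin> Z \<longrightarrow> P u))"

text \<open>At most one \<open>m\<close> satisfies the condition, since \<open>\<nat>\<^sup>n\<close> is Zariski dense. Finiteness is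
  required explicitly because \<open>card\<close> is \<open>0\<close> on infinite sets.\<close>

definition mldeg :: "int ^ 'n ^ 'd::finite \<Rightarrow> complex ^ 'n::finite \<Rightarrow> nat" where
  "mldeg A c = (THE m. for_generic_data
     (\<lambda>u. finite (score_solutions A c u) \<and> card (score_solutions A c u) = m))"

section \<open>The cube\<close>

text \<open>The columns of \<open>A\<close> are the vectors of \<open>{-1,0,1}\<^sup>d\<close>, each occurring exactly once, in any order;
  in particular \<open>CARD('n) = 3 ^ CARD('d)\<close>.\<close>

definition cube_design_matrix :: "int ^ 'n::finite ^ 'd::finite \<Rightarrow> bool" where
  "cube_design_matrix A \<longleftrightarrow>
     bij_betw (\<lambda>i. column i A) UNIV {v. \<forall>k. v $ k \<in> {-1, 0, 1}}"

end

theory Submission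
  imports Defs
begin

text \<open>
  Two facts make the maximum likelihood equations of this model solvable by hand.

  First, the zero vector and the unit vectors are columns of the design matrix, so the parameters
  \<open>s\<close> and \<open>\<theta>\<close> can be read off, as ratios, from any point of the variety with nonzero coordinates.
  The binomial equations of the variety (lemma \<open>toric_binomial\<close>) then force all other coordinates,
  so that taking the Zariski closure adds no points inside the torus
  (lemma \<open>scaled_toric_variety_Int_torus\<close>).

  Second, since the columns form a full product \<open>{-1,0,1}\<^sup>d\<close> and the scaling is a product too, the
  coordinate sum of a parametrised point factors as \<open>s * (\<Prod>k. g\<^sub>k (\<theta>\<^sub>k))\<close> with
  \<open>g\<^sub>k(t) = c\<^sub>k\<^sub>,\<^sub>-\<^sub>1 / t + c\<^sub>k\<^sub>,\<^sub>0 + c\<^sub>k\<^sub>,\<^sub>1 t\<close>, and the score equations decouple into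
  \<open>\<theta>\<^sub>k g\<^sub>k'(\<theta>\<^sub>k) = b\<^sub>k g\<^sub>k(\<theta>\<^sub>k)\<close>, one for each axis, where \<open>b\<^sub>k\<close> is the mean of the data
  in direction \<open>k\<close>. These are quadratic in general. The hypothesis on \<open>c\<close> says that the
  discriminant of \<open>t g\<^sub>k(t)\<close> vanishes, i.e. \<open>g\<^sub>k(t) = (c\<^sub>k\<^sub>,\<^sub>0 + 2 c\<^sub>k\<^sub>,\<^sub>1 t)\<^sup>2 / (4 c\<^sub>k\<^sub>,\<^sub>1 t)\<close>. One linear
  factor cancels, and the remaining equation is linear in \<open>t\<close> (lemma \<open>axis_score_equation\<close>).
  The normalisation \<open>s * (\<Prod>k. g\<^sub>k (\<theta>\<^sub>k)) = 1\<close> finally determines \<open>s\<close>.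

  As generic data all strictly positive vectors are used: they lie outside the union of the
  coordinate hyperplanes, and they are Zariski dense, which makes the degree well defined
  (lemma \<open>mldeg_eqI\<close>).
\<close>

section \<open>Polynomial functions and Zariski closed sets\<close>

lemma poly_value_eq_sum_superset:
  assumes "finite S" "Poly_Mapping.keys f \<subseteq> S"
  shows "poly_value f x = (\<Sum>m\<in>S. Poly_Mapping.lookup f m *
      (\<Prod>i\<in>UNIV. (x $ i) ^ Poly_Mapping.lookup m i))"
  unfolding poly_value_def
  by (rule sum.mono_neutral_left) (use assms in \<open>auto simp: in_keys_iff\<close>)

lemma poly_value_add: "poly_value (f + g) x = poly_value f x + poly_value g x"
proof -
  let ?S = "Poly_Mapping.keys f \<union> Poly_Mapping.keys g"
  have "Poly_Mapping.keys (f + g) \<subseteq> ?S"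
    by (rule keys_add)
  then show ?thesis
    by (simp add: poly_value_eq_sum_superset[of ?S] lookup_add ring_distribs sum.distrib)
qed

lemma poly_value_single:
  "poly_value (Poly_Mapping.single m a) x = a * (\<Prod>i\<in>UNIV. (x $ i) ^ Poly_Mapping.lookup m i)"
  by (subst poly_value_eq_sum_superset[of "{m}"]) auto

lemma zariski_closed_binomial_equation:
  fixes \<alpha> \<beta> :: "'n::finite \<Rightarrow> nat"
  shows "zariski_closed {x. a * (\<Prod>i\<in>UNIV. (x $ i) ^ \<alpha> i) = b * (\<Prod>i\<in>UNIV. (x $ i) ^ \<beta> i)}"
proof -
  let ?f = "Poly_Mapping.single (Abs_poly_mapping \<alpha>) a + Poly_Mapping.single (Abs_poly_mapping \<beta>) (- b)"
  have "poly_value ?f x = a * (\<Prod>i\<in>UNIV. (x $ i) ^ \<alpha> i) - b * (\<Prod>i\<in>UNIV. (x $ i) ^ \<beta> i)" for x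
    by (simp add: poly_value_add poly_value_single)
  then show ?thesis
    unfolding zariski_closed_def by (intro exI[of _ "{?f}"]) simp
qed

lemma zariski_closed_Compl_torus: "zariski_closed (- torus :: (complex ^ 'n::finite) set)"
proof -
  have "- torus = {x :: complex ^ 'n. 1 * (\<Prod>i\<in>UNIV. (x $ i) ^ 1) = 0 * (\<Prod>i\<in>UNIV. (x $ i) ^ 0)}"
    by (auto simp: torus_def)
  then show ?thesis
    by (simp only: zariski_closed_binomial_equation)
qed

lemma zariski_closure_subset:
  assumes "zariski_closed Z" "S \<subseteq> Z"
  shows "zariski_closure S \<subseteq> Z"
  unfolding zariski_closure_def using assms by (intro hull_minimal)

text \<open>The positive integer vectors are Zariski dense. Coordinates are freed from the integrality
  condition one at a time: in each single coordinate the function is a univariate polynomial,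
  which is zero once it vanishes at all positive integers.\<close>

lemma poly_value_zero_if_zero_on_positive_naturals:
  fixes f :: "'n::finite cpoly"
  assumes zero: "\<And>u :: nat ^ 'n. (\<forall>i. u $ i > 0) \<Longrightarrow> poly_value f (\<chi> i. of_nat (u $ i)) = 0"
  shows "poly_value f x = 0"
proof -
  have *: "\<forall>x. (\<forall>i\<in>-S. \<exists>k>0. x $ i = of_nat k) \<longrightarrow> poly_value f x = 0" if "finite S" for S :: "'n set"
    using that
  proof induction
    case empty
    show ?case
    proof (intro allI impI)
      fix x :: "complex ^ 'n"
      assume "\<forall>i\<in>- {}. \<exists>k>0. x $ i = of_nat k"
      then obtain k where k: "\<And>i. k i > 0" "\<And>i. x $ i = of_nat (k i)"
        by (metis Compl_iff empty_iff)
      have "x = (\<chi> i. of_nat ((\<chi> i. k i) $ i))"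
        by (simp add: vec_eq_iff k)
      then show "poly_value f x = 0"
        using zero[of "\<chi> i. k i"] k by simp
    qed
  next
    case (insert i S)
    show ?case
    proof (intro allI impI)
      fix x :: "complex ^ 'n"
      assume x: "\<forall>j\<in>- insert i S. \<exists>k>0. x $ j = of_nat k"
      define y where "y t = (\<chi> j. if j = i then t else x $ j)" for t
      define q where "q = (\<Sum>m\<in>Poly_Mapping.keys f. smult (Poly_Mapping.lookup f m *
          (\<Prod>j\<in>UNIV - {i}. (x $ j) ^ Poly_Mapping.lookup m j)) (monom 1 (Poly_Mapping.lookup m i)))"
      have prod_y: "(\<Prod>j\<in>UNIV. (y t $ j) ^ Poly_Mapping.lookup m j) =
          t ^ Poly_Mapping.lookup m i * (\<Prod>j\<in>UNIV - {i}. (x $ j) ^ Poly_Mapping.lookup m j)"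
        for t and m :: "'n \<Rightarrow>\<^sub>0 nat"
      proof -
        have "(\<Prod>j\<in>UNIV - {i}. (y t $ j) ^ Poly_Mapping.lookup m j) =
            (\<Prod>j\<in>UNIV - {i}. (x $ j) ^ Poly_Mapping.lookup m j)"
          by (rule prod.cong) (auto simp: y_def)
        then show ?thesis
          by (subst prod.remove[of _ i]) (auto simp: y_def)
      qed
      have q: "poly_value f (y t) = poly q t" for t
        unfolding poly_value_def q_def poly_sum prod_y
        by (simp add: poly_monom mult_ac)
      have "poly q (of_nat k) = 0" if "k > 0" for k
      proof -
        have "\<forall>j\<in>- S. \<exists>k'>0. y (of_nat k) $ j = of_nat k'"
          using x that by (auto simp: y_def)
        then show ?thesis
          using insert.IH q by metis
      qed
      then have "of_nat ` {0<..} \<subseteq> {t. poly q t = 0}"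
        by auto
      moreover have "infinite (of_nat ` {0<..} :: complex set)"
        by (subst finite_image_iff) (auto simp: inj_on_def infinite_Ioi)
      ultimately have "q = 0"
        using poly_roots_finite finite_subset by blast
      moreover have "y (x $ i) = x"
        by (simp add: y_def vec_eq_iff)
      ultimately show "poly_value f x = 0"
        using q[of "x $ i"] by simp
    qed
  qed
  show ?thesis
    using *[of UNIV] by simp
qed

text \<open>A nonempty Zariski open set, whichever it is, contains a strictly positive data vector. Hence
  a solution count valid for all positive data is the only possible generic count.\<close>

lemma mldeg_eqI:
  fixes A :: "int ^ 'n::finite ^ 'd::finite"
  assumes count: "\<And>u. (\<forall>i. u $ i > 0) \<Longrightarrow>
    finite (score_solutions A c u) \<and> card (score_solutions A c u) = m"
  shows "mldeg A c = m"
  unfolding mldeg_def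
proof (rule the_equality)
  have "(1 :: complex ^ 'n) \<in> torus"
    by (simp add: torus_def)
  then have "- torus \<noteq> (UNIV :: (complex ^ 'n) set)"
    by blast
  moreover have "\<forall>i. u $ i > 0" if "(\<chi> i. of_nat (u $ i)) \<notin> - torus" for u :: "nat ^ 'n"
    using that by (simp add: torus_def)
  ultimately show "for_generic_data (\<lambda>u. finite (score_solutions A c u) \<and> card (score_solutions A c u) = m)"
    unfolding for_generic_data_def
    using zariski_closed_Compl_torus count by blast
next
  fix m'
  assume "for_generic_data (\<lambda>u. finite (score_solutions A c u) \<and> card (score_solutions A c u) = m')"
  then obtain F where F: "{x. \<forall>f\<in>F. poly_value f x = 0} \<noteq> UNIV"
    and m': "\<And>u. (\<chi> i. of_nat (u $ i)) \<notin> {x. \<forall>f\<in>F. poly_value f x = 0} \<Longrightarrow>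
      card (score_solutions A c u) = m'"
    unfolding for_generic_data_def zariski_closed_def by blast
  from F obtain f x where f: "f \<in> F" "poly_value f x \<noteq> 0"
    by blast
  then obtain u :: "nat ^ 'n" where "\<forall>i. u $ i > 0" "poly_value f (\<chi> i. of_nat (u $ i)) \<noteq> 0"
    using poly_value_zero_if_zero_on_positive_naturals by metis
  then show "m' = m"
    using m'[of u] count[of u] f by blast
qed

section \<open>Points of a scaled toric variety inside the torus\<close>

lemma power_int_sum:
  fixes t :: "'a::field"
  assumes "t \<noteq> 0"
  shows "t powi (\<Sum>i\<in>I. f i) = (\<Prod>i\<in>I. t powi f i)"
  using assms by (induction I rule: infinite_finite_induct) (auto simp: power_int_add)

lemma prod_monomial_powers:
  fixes \<theta> :: "complex ^ 'd::finite" and \<alpha> :: "'n::finite \<Rightarrow> nat"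
  assumes "\<theta> \<in> torus"
  shows "(\<Prod>i\<in>UNIV. (s * (\<Prod>k\<in>UNIV. (\<theta> $ k) powi (A $ k $ i))) ^ \<alpha> i) =
    s ^ (\<Sum>i\<in>UNIV. \<alpha> i) * (\<Prod>k\<in>UNIV. (\<theta> $ k) powi (\<Sum>i\<in>UNIV. A $ k $ i * int (\<alpha> i)))"
proof -
  have "(\<Prod>i\<in>UNIV. (\<Prod>k\<in>UNIV. (\<theta> $ k) powi (A $ k $ i)) ^ \<alpha> i) =
      (\<Prod>i\<in>UNIV. \<Prod>k\<in>UNIV. (\<theta> $ k) powi (A $ k $ i * int (\<alpha> i)))"
    by (simp add: prod_power_distrib power_int_power')
  also have "\<dots> = (\<Prod>k\<in>UNIV. \<Prod>i\<in>UNIV. (\<theta> $ k) powi (A $ k $ i * int (\<alpha> i)))"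
    by (rule prod.swap)
  also have "\<dots> = (\<Prod>k\<in>UNIV. (\<theta> $ k) powi (\<Sum>i\<in>UNIV. A $ k $ i * int (\<alpha> i)))"
    using assms by (simp add: power_int_sum torus_def)
  finally show ?thesis
    by (simp add: power_mult_distrib prod.distrib power_sum)
qed

text \<open>Affine relations among the columns give binomials in the ideal of the scaled toric variety:
  both monomials take the same value at every parametrised point, and equality of two monomials is
  a Zariski closed condition.\<close>

lemma toric_binomial:
  fixes A :: "int ^ 'n::finite ^ 'd::finite" and \<alpha> \<beta> :: "'n \<Rightarrow> nat"
  assumes p: "p \<in> scaled_toric_variety A c" and c: "c \<in> torus"
    and deg: "(\<Sum>i\<in>UNIV. \<alpha> i) = (\<Sum>i\<in>UNIV. \<beta> i)"
    and rel: "\<And>k. (\<Sum>i\<in>UNIV. A $ k $ i * int (\<alpha> i)) = (\<Sum>i\<in>UNIV. A $ k $ i * int (\<beta> i))"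
  shows "(\<Prod>i\<in>UNIV. (p $ i / c $ i) ^ \<alpha> i) = (\<Prod>i\<in>UNIV. (p $ i / c $ i) ^ \<beta> i)"
proof -
  define Z where "Z = {x. (\<Prod>i\<in>UNIV. (x $ i / c $ i) ^ \<alpha> i) = (\<Prod>i\<in>UNIV. (x $ i / c $ i) ^ \<beta> i)}"
  have "Z = {x. inverse (\<Prod>i\<in>UNIV. (c $ i) ^ \<alpha> i) * (\<Prod>i\<in>UNIV. (x $ i) ^ \<alpha> i) =
      inverse (\<Prod>i\<in>UNIV. (c $ i) ^ \<beta> i) * (\<Prod>i\<in>UNIV. (x $ i) ^ \<beta> i)}"
    by (simp add: Z_def power_divide prod_dividef) (simp add: divide_inverse mult.commute)
  then have "zariski_closed Z"
    by (simp only: zariski_closed_binomial_equation)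
  moreover have "toric_param A c s \<theta> \<in> Z" if \<theta>: "\<theta> \<in> torus" for s \<theta>
  proof -
    have "toric_param A c s \<theta> $ i / c $ i = s * (\<Prod>k\<in>UNIV. (\<theta> $ k) powi (A $ k $ i))" for i
      using c by (simp add: toric_param_def torus_def)
    then show ?thesis
      by (simp add: Z_def prod_monomial_powers[OF \<theta>] deg rel)
  qed
  ultimately have "scaled_toric_variety A c \<subseteq> Z"
    unfolding scaled_toric_variety_def by (intro zariski_closure_subset) auto
  with p show ?thesis
    by (auto simp: Z_def)
qed

lemma toric_param_in_scaled_toric_variety:
  assumes "s \<noteq> 0" "\<theta> \<in> torus"
  shows "toric_param A c s \<theta> \<in> scaled_toric_variety A c"
  unfolding scaled_toric_variety_def zariski_closure_def
  by (rule hull_inc) (use assms in blast)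

lemma toric_param_in_torus:
  assumes "s \<noteq> 0" "\<theta> \<in> torus" "c \<in> torus"
  shows "toric_param A c s \<theta> \<in> torus"
  using assms by (simp add: torus_def toric_param_def)

text \<open>Splitting a column \<open>a\<^sub>i\<close> into positive and negative parts over the unit columns, and balancing
  degrees with the zero column, gives a binomial that contains the \<open>i\<close>-th coordinate linearly, next to
  the coordinates of the zero and unit columns only. At points of the torus it can be solved for the
  \<open>i\<close>-th coordinate, and the others give \<open>s\<close> and \<open>\<theta>\<close>.\<close>

lemma scaled_toric_variety_Int_torus:
  fixes A :: "int ^ 'n::finite ^ 'd::finite"
  assumes c: "c \<in> torus"
    and z: "\<And>k. A $ k $ z = 0"
    and e: "\<And>k l. A $ k $ e l = (if k = l then 1 else 0)"
  shows "scaled_toric_variety A c \<inter> torus = {toric_param A c s \<theta> | s \<theta>. s \<noteq> 0 \<and> \<theta> \<in> torus}"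
proof (intro equalityI subsetI)
  fix p
  assume "p \<in> scaled_toric_variety A c \<inter> torus"
  then have p: "p \<in> scaled_toric_variety A c" and p0: "\<And>i. p $ i \<noteq> 0"
    by (auto simp: torus_def)
  have c0: "\<And>i. c $ i \<noteq> 0"
    using c by (auto simp: torus_def)
  define x where "x i = p $ i / c $ i" for i
  have x0: "x i \<noteq> 0" for i
    by (simp add: x_def p0 c0)
  define s where "s = x z"
  define \<theta> where "\<theta> = (\<chi> k. x (e k) / s)"
  have s0: "s \<noteq> 0" and \<theta>0: "\<theta> $ k \<noteq> 0" and xe: "x (e k) = s * \<theta> $ k" for k
    by (auto simp: s_def \<theta>_def x0)
  have "x i = s * (\<Prod>k\<in>UNIV. (\<theta> $ k) powi (A $ k $ i))" for i
  proof -
    define P where "P k = nat (A $ k $ i)" for k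
    define N where "N k = nat (- A $ k $ i)" for k
    \<comment> \<open>Exponents of \<open>x\<^sub>i\<^sup>a x\<^sub>z\<^sup>b (\<Prod>k. x\<^sub>e\<^sub>k ^ q k)\<close>. They are added up because \<open>i\<close> may itself be \<open>z\<close> or some \<open>e k\<close>.\<close>
    define mon :: "nat \<Rightarrow> nat \<Rightarrow> ('d \<Rightarrow> nat) \<Rightarrow> 'n \<Rightarrow> nat" where
      "mon a b q j = (if j = i then a else 0) + (if j = z then b else 0) +
        (\<Sum>k\<in>UNIV. if j = e k then q k else 0)" for a b q j
    have prod_mon: "(\<Prod>j\<in>UNIV. x j ^ mon a b q j) = x i ^ a * x z ^ b * (\<Prod>k\<in>UNIV. x (e k) ^ q k)"
      for a b q
    proof -
      have "(\<Prod>j\<in>UNIV. x j ^ (if j = l then n else 0)) = x l ^ n" for l n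
      proof -
        have "(\<Prod>j\<in>UNIV. x j ^ (if j = l then n else 0)) = (\<Prod>j\<in>UNIV. if j = l then x j ^ n else 1)"
          by (rule prod.cong) auto
        then show ?thesis
          by simp
      qed
      moreover have "(\<Prod>j\<in>UNIV. \<Prod>k\<in>UNIV. x j ^ (if j = e k then q k else 0)) =
          (\<Prod>k\<in>UNIV. \<Prod>j\<in>UNIV. x j ^ (if j = e k then q k else 0))"
        by (rule prod.swap)
      ultimately show ?thesis
        by (simp add: mon_def power_add power_sum prod.distrib)
    qed
    have sum_mon: "(\<Sum>j\<in>UNIV. w j * int (mon a b q j)) =
        w i * int a + w z * int b + (\<Sum>k\<in>UNIV. w (e k) * int (q k))" for w a b q
    proof -
      have delta: "(\<Sum>j\<in>UNIV. w j * int (if j = l then n else 0)) = w l * int n" for l n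
      proof -
        have "(\<Sum>j\<in>UNIV. w j * int (if j = l then n else 0)) = (\<Sum>j\<in>UNIV. if j = l then w j * int n else 0)"
          by (rule sum.cong) auto
        then show ?thesis
          by simp
      qed
      have swap: "(\<Sum>j\<in>UNIV. \<Sum>k\<in>UNIV. w j * int (if j = e k then q k else 0)) =
          (\<Sum>k\<in>UNIV. \<Sum>j\<in>UNIV. w j * int (if j = e k then q k else 0))"
        by (rule sum.swap)
      show ?thesis
        by (simp only: mon_def of_nat_add of_nat_sum ring_distribs sum.distrib sum_distrib_left
            delta swap)
    qed
    let ?\<alpha> = "mon 1 (\<Sum>k\<in>UNIV. P k) N" and ?\<beta> = "mon 0 (1 + (\<Sum>k\<in>UNIV. N k)) P"
    have "int (\<Sum>j\<in>UNIV. ?\<alpha> j) = int (\<Sum>j\<in>UNIV. ?\<beta> j)"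
      using sum_mon[of "\<lambda>_. 1" 1 "\<Sum>k\<in>UNIV. P k" N] sum_mon[of "\<lambda>_. 1" 0 "1 + (\<Sum>k\<in>UNIV. N k)" P]
      by simp
    then have deg: "(\<Sum>j\<in>UNIV. ?\<alpha> j) = (\<Sum>j\<in>UNIV. ?\<beta> j)"
      by (simp only: of_nat_eq_iff)
    have unit: "(\<Sum>l\<in>UNIV. A $ k $ e l * int (q l)) = int (q k)" for k q
    proof -
      have "(\<Sum>l\<in>UNIV. A $ k $ e l * int (q l)) = (\<Sum>l\<in>UNIV. if k = l then int (q l) else 0)"
        by (rule sum.cong) (auto simp: e)
      then show ?thesis
        by simp
    qed
    have rel: "(\<Sum>j\<in>UNIV. A $ k $ j * int (?\<alpha> j)) = (\<Sum>j\<in>UNIV. A $ k $ j * int (?\<beta> j))" for k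
      unfolding sum_mon unit z by (simp add: P_def N_def)
    have "(\<Prod>j\<in>UNIV. x j ^ ?\<alpha> j) = (\<Prod>j\<in>UNIV. x j ^ ?\<beta> j)"
      unfolding x_def by (rule toric_binomial[OF p c deg rel])
    then have "x i * s ^ (\<Sum>k\<in>UNIV. P k) * (s ^ (\<Sum>k\<in>UNIV. N k) * (\<Prod>k\<in>UNIV. (\<theta> $ k) ^ N k)) =
        s * s ^ (\<Sum>k\<in>UNIV. N k) * (s ^ (\<Sum>k\<in>UNIV. P k) * (\<Prod>k\<in>UNIV. (\<theta> $ k) ^ P k))"
      unfolding prod_mon xe by (simp add: s_def[symmetric] power_mult_distrib prod.distrib power_sum)
    then have "x i * (\<Prod>k\<in>UNIV. (\<theta> $ k) ^ N k) = s * (\<Prod>k\<in>UNIV. (\<theta> $ k) ^ P k)"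
      using s0 by (simp add: mult_ac)
    moreover have "(\<theta> $ k) ^ P k = (\<theta> $ k) powi (A $ k $ i) * (\<theta> $ k) ^ N k" for k
      by (cases "A $ k $ i \<ge> 0") (auto simp: P_def N_def power_int_def \<theta>0 power_inverse)
    ultimately show ?thesis
      by (simp add: prod.distrib \<theta>0)
  qed
  then have "p = toric_param A c s \<theta>"
    by (simp add: vec_eq_iff toric_param_def x_def c0 field_simps)
  then show "p \<in> {toric_param A c s \<theta> | s \<theta>. s \<noteq> 0 \<and> \<theta> \<in> torus}"
    using s0 \<theta>0 by (auto simp: torus_def)
next
  fix p
  assume "p \<in> {toric_param A c s \<theta> | s \<theta>. s \<noteq> 0 \<and> \<theta> \<in> torus}"
  then show "p \<in> scaled_toric_variety A c \<inter> torus"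
    using c toric_param_in_scaled_toric_variety toric_param_in_torus by auto
qed

lemma mem_score_solutions_iff:
  "p \<in> score_solutions A c u \<longleftrightarrow> p \<in> scaled_toric_variety A c \<inter> torus \<and>
    (\<Sum>i\<in>UNIV. p $ i) = of_nat (\<Sum>i\<in>UNIV. u $ i) / of_nat (\<Sum>i\<in>UNIV. u $ i) \<and>
    (\<forall>k. (\<Sum>i\<in>UNIV. of_int (A $ k $ i) * p $ i) =
      (\<Sum>i\<in>UNIV. of_int (A $ k $ i) * of_nat (u $ i)) / of_nat (\<Sum>i\<in>UNIV. u $ i))"
  by (simp add: score_solutions_def Let_def vec_eq_iff matrix_vector_mult_def augment_def
      split_option_all)

section \<open>Factorisation over the axes of the cube\<close>

lemma sum_over_cube_columns:
  fixes A :: "int ^ 'n::finite ^ 'd::finite" and h :: "'d \<Rightarrow> int \<Rightarrow> complex"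
  assumes "cube_design_matrix A"
  shows "(\<Sum>i\<in>UNIV. \<Prod>k\<in>UNIV. h k (A $ k $ i)) = (\<Prod>k\<in>UNIV. \<Sum>j\<in>{-1, 0, 1}. h k j)"
proof -
  let ?C = "{v :: int ^ 'd. \<forall>k. v $ k \<in> {-1, 0, 1}}"
  let ?F = "\<lambda>v :: int ^ 'd. \<Prod>k\<in>UNIV. h k (v $ k)"
  have "(\<Sum>i\<in>UNIV. \<Prod>k\<in>UNIV. h k (A $ k $ i)) = (\<Sum>i\<in>UNIV. ?F (column i A))"
    by (simp add: column_def)
  also have "\<dots> = (\<Sum>v\<in>?C. ?F v)"
    using assms unfolding cube_design_matrix_def by (rule sum.reindex_bij_betw)
  also have "\<dots> = (\<Sum>g\<in>PiE UNIV (\<lambda>_. {-1, 0, 1}). \<Prod>k\<in>UNIV. h k (g k))"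
    by (rule sum.reindex_bij_witness[of _ vec_lambda vec_nth]) (auto simp: PiE_def Pi_def)
  also have "\<dots> = (\<Prod>k\<in>UNIV. \<Sum>j\<in>{-1, 0, 1}. h k j)"
    by (rule prod_sum_PiE[symmetric]) auto
  finally show ?thesis .
qed

text \<open>The Laurent polynomial \<open>g\<close> of one axis with coefficients \<open>a\<close>, and its logarithmic-derivative
  numerator \<open>t * g' t\<close>.\<close>

definition axis_sum :: "(int \<Rightarrow> complex) \<Rightarrow> complex \<Rightarrow> complex" where
  "axis_sum a t = (\<Sum>j\<in>{-1, 0, 1}. a j * t powi j)"

definition axis_moment :: "(int \<Rightarrow> complex) \<Rightarrow> complex \<Rightarrow> complex" where
  "axis_moment a t = (\<Sum>j\<in>{-1, 0, 1}. of_int j * (a j * t powi j))"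

lemma toric_param_product_scaling:
  assumes "\<And>i. c $ i = (\<Prod>k\<in>UNIV. ck k (A $ k $ i))"
  shows "toric_param A c s \<theta> $ i = s * (\<Prod>k\<in>UNIV. ck k (A $ k $ i) * (\<theta> $ k) powi (A $ k $ i))"
  by (simp add: toric_param_def assms prod.distrib)

lemma cube_coordinate_sum:
  fixes A :: "int ^ 'n::finite ^ 'd::finite"
  assumes "cube_design_matrix A" "\<And>i. c $ i = (\<Prod>k\<in>UNIV. ck k (A $ k $ i))"
  shows "(\<Sum>i\<in>UNIV. toric_param A c s \<theta> $ i) = s * (\<Prod>k\<in>UNIV. axis_sum (ck k) (\<theta> $ k))"
  using sum_over_cube_columns[OF assms(1), of "\<lambda>k j. ck k j * (\<theta> $ k) powi j"]
  by (simp only: toric_param_product_scaling[OF assms(2)] sum_distrib_left[symmetric] axis_sum_def)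

lemma cube_coordinate_moment:
  fixes A :: "int ^ 'n::finite ^ 'd::finite"
  assumes "cube_design_matrix A" "\<And>i. c $ i = (\<Prod>k\<in>UNIV. ck k (A $ k $ i))"
  shows "(\<Sum>i\<in>UNIV. of_int (A $ k $ i) * toric_param A c s \<theta> $ i) =
    s * (axis_moment (ck k) (\<theta> $ k) * (\<Prod>l\<in>UNIV - {k}. axis_sum (ck l) (\<theta> $ l)))"
proof -
  \<comment> \<open>The weight is absorbed into the factor of axis \<open>k\<close>, so that the sum still factors.\<close>
  define h where "h l j = (if l = k then of_int j else 1) * (ck l j * (\<theta> $ l) powi j)" for l j
  have "(\<Prod>l\<in>UNIV. h l (A $ l $ i)) =
      of_int (A $ k $ i) * (\<Prod>l\<in>UNIV. ck l (A $ l $ i) * (\<theta> $ l) powi (A $ l $ i))" for i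
    unfolding h_def prod.distrib[of "\<lambda>l. if l = k then _ l else _ l"] by simp
  then have "(\<Sum>i\<in>UNIV. of_int (A $ k $ i) * toric_param A c s \<theta> $ i) =
      s * (\<Sum>i\<in>UNIV. \<Prod>l\<in>UNIV. h l (A $ l $ i))"
    by (simp add: toric_param_product_scaling[OF assms(2)] sum_distrib_left mult_ac)
  also have "(\<Sum>i\<in>UNIV. \<Prod>l\<in>UNIV. h l (A $ l $ i)) = (\<Prod>l\<in>UNIV. \<Sum>j\<in>{-1, 0, 1}. h l j)"
    by (rule sum_over_cube_columns[OF assms(1)])
  also have "\<dots> = (\<Sum>j\<in>{-1, 0, 1}. h k j) * (\<Prod>l\<in>UNIV - {k}. \<Sum>j\<in>{-1, 0, 1}. h l j)"
    by (rule prod.remove) auto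
  also have "(\<Sum>j\<in>{-1, 0, 1}. h k j) = axis_moment (ck k) (\<theta> $ k)"
    by (simp only: h_def axis_moment_def if_True simp_thms)
  also have "(\<Prod>l\<in>UNIV - {k}. \<Sum>j\<in>{-1, 0, 1}. h l j) = (\<Prod>l\<in>UNIV - {k}. axis_sum (ck l) (\<theta> $ l))"
    by (rule prod.cong) (auto simp: h_def axis_sum_def)
  finally show ?thesis .
qed

text \<open>The normalisation makes \<open>s\<close> times the product over the other axes equal to \<open>1 / G k\<close>, which
  removes these axes from the \<open>k\<close>-th equation.\<close>

lemma score_equations_decouple:
  fixes s :: complex and G D b :: "'d::finite \<Rightarrow> complex"
  assumes norm: "s * (\<Prod>k\<in>UNIV. G k) = 1"
  shows "s * (D k * (\<Prod>l\<in>UNIV - {k}. G l)) = b k \<longleftrightarrow> D k = b k * G k"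
proof -
  have prod: "(\<Prod>k\<in>UNIV. G k) = G k * (\<Prod>l\<in>UNIV - {k}. G l)"
    by (rule prod.remove) auto
  then have G: "s * (\<Prod>l\<in>UNIV - {k}. G l) * G k = 1" and "G k \<noteq> 0"
    using norm by (auto simp: mult_ac)
  then have "s * (\<Prod>l\<in>UNIV - {k}. G l) = 1 / G k"
    by (simp add: field_simps)
  then have "s * (D k * (\<Prod>l\<in>UNIV - {k}. G l)) = D k / G k"
    by (metis mult.assoc mult.commute times_divide_eq_right mult_1_right)
  then show ?thesis
    using \<open>G k \<noteq> 0\<close> by (simp add: divide_eq_eq)
qed

text \<open>With \<open>a\<^sub>0\<^sup>2 = 4 a\<^sub>-\<^sub>1 a\<^sub>1\<close>, both sides of the score equation of one axis have the factor
  \<open>(a\<^sub>0 + 2 a\<^sub>1 t) / (4 a\<^sub>1 t)\<close>. After cancellation \<open>2 a\<^sub>1 t - a\<^sub>0 = b (2 a\<^sub>1 t + a\<^sub>0)\<close> is left.\<close>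

lemma axis_score_equation:
  assumes a: "a (-1) = (a 0)\<^sup>2 / (4 * a 1)" "a 0 \<noteq> 0" "a 1 \<noteq> 0" and t: "t \<noteq> 0" and b: "b \<noteq> 1"
  shows "axis_sum a t \<noteq> 0 \<and> axis_moment a t = b * axis_sum a t \<longleftrightarrow>
    t = a 0 * (1 + b) / (2 * a 1 * (1 - b))"
proof -
  define w where "w = 2 * a 1 * t"
  have w: "w \<noteq> 0"
    using a t by (simp add: w_def)
  have S: "axis_sum a t = (w + a 0) * ((w + a 0) / (2 * w))"
    and M: "axis_moment a t = (w - a 0) * ((w + a 0) / (2 * w))"
    using a t by (simp_all add: axis_sum_def axis_moment_def w_def field_simps power2_eq_square)
  have "axis_sum a t \<noteq> 0 \<and> axis_moment a t = b * axis_sum a t \<longleftrightarrow>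
      w + a 0 \<noteq> 0 \<and> w - a 0 = b * (w + a 0)"
    using w unfolding S M by auto
  also have "w - a 0 = b * (w + a 0) \<longleftrightarrow> w * (1 - b) = a 0 * (1 + b)"
    by (auto simp: algebra_simps)
  also have "w + a 0 \<noteq> 0 \<and> w * (1 - b) = a 0 * (1 + b) \<longleftrightarrow> w * (1 - b) = a 0 * (1 + b)"
  proof -
    have "w + a 0 \<noteq> 0" if "w * (1 - b) = a 0 * (1 + b)"
    proof
      assume "w + a 0 = 0"
      then have "w = - a 0"
        by (simp add: eq_neg_iff_add_eq_0)
      with that show False
        using a by (simp add: algebra_simps)
    qed
    then show ?thesis
      by blast
  qed
  also have "\<dots> \<longleftrightarrow> t = a 0 * (1 + b) / (2 * a 1 * (1 - b))"
    using a b by (simp add: w_def field_simps)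
  finally show ?thesis .
qed

section \<open>The maximum likelihood degree of the cube\<close>

text \<open>The zero column separates the mean of positive data from the endpoints of \<open>[-1,1]\<close>.\<close>

lemma mean_neq_endpoint:
  fixes w :: "'n::finite \<Rightarrow> int" and u :: "nat ^ 'n"
  assumes u: "\<forall>i. u $ i > 0" and w: "\<And>i. w i \<in> {-1, 0, 1}" "w z = 0" and r: "r \<in> {-1, 1}"
  shows "(\<Sum>i\<in>UNIV. of_int (w i) * of_nat (u $ i)) / of_nat (\<Sum>i\<in>UNIV. u $ i) \<noteq> (of_int r :: complex)"
proof
  assume eq: "(\<Sum>i\<in>UNIV. of_int (w i) * of_nat (u $ i)) / of_nat (\<Sum>i\<in>UNIV. u $ i) = (of_int r :: complex)"
  have "(\<Sum>i\<in>UNIV. u $ i) > 0"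
    using u by (intro sum_pos) auto
  then have "(\<Sum>i\<in>UNIV. of_int (w i) * of_nat (u $ i)) = of_int r * (of_nat (\<Sum>i\<in>UNIV. u $ i) :: complex)"
    using eq by (simp add: divide_eq_eq del: of_nat_sum sum_eq_0_iff)
  then have "(of_int (\<Sum>i\<in>UNIV. w i * int (u $ i)) :: complex) = of_int (r * (\<Sum>i\<in>UNIV. int (u $ i)))"
    by simp
  then have "(\<Sum>i\<in>UNIV. w i * int (u $ i)) = r * (\<Sum>i\<in>UNIV. int (u $ i))"
    by (simp only: of_int_eq_iff)
  then have "(\<Sum>i\<in>UNIV. (1 - r * w i) * int (u $ i)) = 0"
    using r by (auto simp: algebra_simps sum.distrib sum_subtractf sum_negf)
  moreover have "(\<Sum>i\<in>UNIV. (1 - r * w i) * int (u $ i)) > 0"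
  proof (rule sum_pos2[of _ z])
    show "(1 - r * w i) * int (u $ i) \<ge> 0" for i
      using w(1)[of i] r by auto
  qed (use u w in auto)
  ultimately show False
    by simp
qed

theorem theorem5p9:
  fixes A :: "int ^ 'n::finite ^ 'd::finite"
    and ck :: "'d \<Rightarrow> int \<Rightarrow> complex"
    and c :: "complex ^ 'n"
  assumes "cube_design_matrix A"
    and "\<And>k j. j \<in> {-1, 0, 1} \<Longrightarrow> ck k j \<noteq> 0"
    and "\<And>i. c $ i = (\<Prod>k\<in>UNIV. ck k (A $ k $ i))"
    and "\<And>k. ck k (-1) = (ck k 0)\<^sup>2 / (4 * ck k 1)"
  shows "mldeg A c = 1"
proof (rule mldeg_eqI)
  fix u :: "nat ^ 'n"
  assume u: "\<forall>i. u $ i > 0"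
  have entries: "A $ k $ i \<in> {-1, 0, 1}" for k i
  proof -
    have "column i A \<in> {v. \<forall>k. v $ k \<in> {-1, 0, 1}}"
      using assms(1) unfolding cube_design_matrix_def by (rule bij_betw_apply) simp
    then show ?thesis
      by (simp add: column_def)
  qed
  have columns: "\<exists>i. \<forall>k. A $ k $ i = v k" if "\<And>k. v k \<in> {-1, 0, 1}" for v
  proof -
    have "(\<chi> k. v k) \<in> range (\<lambda>i. column i A)"
      using assms(1) that unfolding cube_design_matrix_def bij_betw_def by simp
    then show ?thesis
      by (auto simp: column_def vec_eq_iff)
  qed
  obtain z where z: "\<And>k. A $ k $ z = 0"
    using columns[of "\<lambda>_. 0"] by auto
  have "\<forall>l. \<exists>i. \<forall>k. A $ k $ i = (if k = l then 1 else 0)"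
    by (intro allI columns) auto
  then obtain e where e: "\<And>k l. A $ k $ e l = (if k = l then 1 else 0)"
    by metis
  have c: "c \<in> torus"
    unfolding torus_def using assms(2,3) entries by simp

  define b :: "'d \<Rightarrow> complex" where
    "b k = (\<Sum>i\<in>UNIV. of_int (A $ k $ i) * of_nat (u $ i)) / of_nat (\<Sum>i\<in>UNIV. u $ i)" for k
  have b: "b k \<noteq> 1" "b k \<noteq> -1" for k
    using mean_neq_endpoint[OF u, of "\<lambda>i. A $ k $ i" z 1] entries z
      mean_neq_endpoint[OF u, of "\<lambda>i. A $ k $ i" z "-1"]
    by (auto simp: b_def)
  have "(\<Sum>i\<in>UNIV. u $ i) > 0"
    using u by (intro sum_pos) auto
  then have u1: "of_nat (\<Sum>i\<in>UNIV. u $ i) / of_nat (\<Sum>i\<in>UNIV. u $ i) = (1 :: complex)"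
    by (simp del: of_nat_sum sum_eq_0_iff)

  let ?G = "\<lambda>\<theta> k. axis_sum (ck k) (\<theta> $ k)" and ?D = "\<lambda>\<theta> k. axis_moment (ck k) (\<theta> $ k)"
  define \<theta>' where "\<theta>' = (\<chi> k. ck k 0 * (1 + b k) / (2 * ck k 1 * (1 - b k)))"
  define s' where "s' = 1 / (\<Prod>k\<in>UNIV. ?G \<theta>' k)"
  have axis: "?G \<theta> k \<noteq> 0 \<and> ?D \<theta> k = b k * ?G \<theta> k \<longleftrightarrow> \<theta> $ k = \<theta>' $ k" if "\<theta> \<in> torus" for \<theta> k
    using axis_score_equation[of "ck k" "\<theta> $ k" "b k"] assms(2,4) b that
    by (simp add: torus_def \<theta>'_def)
  have "1 + b k \<noteq> 0" for k
    using b(2)[of k] by (simp add: add_eq_0_iff)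
  then have \<theta>': "\<theta>' \<in> torus"
    using assms(2) b by (simp add: torus_def \<theta>'_def)
  then have G': "?G \<theta>' k \<noteq> 0" for k
    using axis by blast
  then have s': "s' \<noteq> 0"
    by (simp add: s'_def)

  have solution_iff: "toric_param A c s \<theta> \<in> score_solutions A c u \<longleftrightarrow> s = s' \<and> \<theta> = \<theta>'"
    if "s \<noteq> 0" "\<theta> \<in> torus" for s \<theta>
  proof -
    have "toric_param A c s \<theta> \<in> score_solutions A c u \<longleftrightarrow>
        s * (\<Prod>k\<in>UNIV. ?G \<theta> k) = 1 \<and> (\<forall>k. s * (?D \<theta> k * (\<Prod>l\<in>UNIV - {k}. ?G \<theta> l)) = b k)"
      unfolding mem_score_solutions_iff u1 b_def[symmetric]
        cube_coordinate_sum[OF assms(1,3)] cube_coordinate_moment[OF assms(1,3)]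
      by (simp add: toric_param_in_scaled_toric_variety[OF that] toric_param_in_torus[OF that c])
    also have "\<dots> \<longleftrightarrow> s * (\<Prod>k\<in>UNIV. ?G \<theta> k) = 1 \<and> (\<forall>k. ?D \<theta> k = b k * ?G \<theta> k)"
      using score_equations_decouple[of s "?G \<theta>" "?D \<theta>" _ b] by blast
    also have "\<dots> \<longleftrightarrow> s * (\<Prod>k\<in>UNIV. ?G \<theta> k) = 1 \<and> (\<forall>k. ?G \<theta> k \<noteq> 0 \<and> ?D \<theta> k = b k * ?G \<theta> k)"
    proof -
      have "\<forall>k. ?G \<theta> k \<noteq> 0" if "s * (\<Prod>k\<in>UNIV. ?G \<theta> k) = 1"
      proof -
        from that have "(\<Prod>k\<in>UNIV. ?G \<theta> k) \<noteq> 0"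
          by (metis mult_zero_right zero_neq_one)
        then show ?thesis
          by simp
      qed
      then show ?thesis
        by blast
    qed
    also have "\<dots> \<longleftrightarrow> s * (\<Prod>k\<in>UNIV. ?G \<theta> k) = 1 \<and> \<theta> = \<theta>'"
      using axis[OF that(2)] by (auto simp: vec_eq_iff)
    also have "\<dots> \<longleftrightarrow> s = s' \<and> \<theta> = \<theta>'"
      using G' by (auto simp: s'_def field_simps)
    finally show ?thesis .
  qed
  have "score_solutions A c u = {toric_param A c s' \<theta>'}"
  proof (intro equalityI subsetI)
    fix p
    assume p: "p \<in> score_solutions A c u"
    then have "p \<in> scaled_toric_variety A c \<inter> torus"
      by (simp add: mem_score_solutions_iff)
    then obtain s \<theta> where "p = toric_param A c s \<theta>" "s \<noteq> 0" "\<theta> \<in> torus"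
      unfolding scaled_toric_variety_Int_torus[OF c z e] by blast
    with p solution_iff show "p \<in> {toric_param A c s' \<theta>'}"
      by auto
  next
    fix p
    assume "p \<in> {toric_param A c s' \<theta>'}"
    then show "p \<in> score_solutions A c u"
      using solution_iff[OF s' \<theta>'] by simp
  qed
  then show "finite (score_solutions A c u) \<and> card (score_solutions A c u) = 1"
    by simp
qed

end
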